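(* For all $x \in \mathbb{R}$, $\displaystyle \frac{d}{dx} e^x = e^x$, where $e$ is the unique positive real number such that $\ln e = 1$ and $\ln a$ is defined as the derivative at $x = 0$ of $x \mapsto a^x$.
   Context: For real $a > 0$, $a^x$ ($x \in \mathbb{R}$) is the continuous extension to $\mathbb{R}$ of the function $q \mapsto a^q$ defined on $\mathbb{Q}$ (rational powers). Equivalently, $a^x = \sup\{a^q : q \in \mathbb{Q},\ q < x\}$ if $a \ge 1$, and $a^x = \inf\{a^q : q \in \mathbb{Q},\ q < x\}$ if $0 < a < 1$. For every real $a>0$ the function $x \mapsto a^x$ is differentiable at $0$, and $\ln : (0,\infty) \to \mathbb{R}$ is defined by $\ln a = \left.\frac{d}{dx} a^x\right|_{x=0}$, i.e. $\ln a = \lim_{h \to 0} \frac{a^h - 1}{h}$. There is a unique real number $e > 0$ with $\ln e = 1$; this is the definition of $e$. *)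

theory Defs
  imports "HOL-Analysis.Analysis"
begin

text \<open>The library's \<open>powr\<close> is defined through \<open>ln\<close> and \<open>exp\<close>, so the real power is built here
  from integer powers and roots, as the unique continuous extension of the rational power.
  The definitions are meant for \<open>a > 0\<close>.\<close>

definition rat_power :: "real \<Rightarrow> rat \<Rightarrow> real" where
  "rat_power a q = (case quotient_of q of (m, n) \<Rightarrow> root (nat n) a powi m)"

definition real_power :: "real \<Rightarrow> real \<Rightarrow> real" where
  "real_power a = (THE f. continuous_on UNIV f \<and> (\<forall>q. f (of_rat q) = rat_power a q))"

definition nat_log :: "real \<Rightarrow> real" where
  "nat_log a = deriv (\<lambda>x. real_power a x) 0"

definition euler_e :: real where
  "euler_e = (THE e. e > 0 \<and> nat_log e = 1)"

end

theory Submission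
  imports Defs
begin

text \<open>For \<open>a > 0\<close> the function \<open>a powr x\<close> is continuous and agrees with the rational powers on the
  dense set \<open>\<rat>\<close>, so it is the continuous extension. Hence its derivative at \<open>0\<close> is the library's
  \<open>ln a\<close>, and \<open>ln e = 1\<close> forces \<open>e = exp 1\<close>, whose real powers are given by \<open>exp\<close>.\<close>

text \<open>For positive \<open>a\<close> both \<open>root\<close> and \<open>powi\<close> are
  instances of \<open>powr\<close>, and iterated exponents multiply, giving
  \<open>m / n\<close>.\<close>

lemma rat_power_eq_powr:
  assumes "a > 0"
  shows "rat_power a q = a powr of_rat q"
proof -
  obtain m n where q: "quotient_of q = (m, n)"
    by (cases "quotient_of q")
  then have n: "n > 0"
    by (rule quotient_of_denom_pos)
  have "root (nat n) a powi m = (a powr (1 / n)) powi m"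
    using n assms by (simp add: root_powr_inverse)
  also have "\<dots> = a powr (m / n)"
    using assms by (simp add: powr_real_of_int' [symmetric] powr_powr)
  also have "real_of_int m / real_of_int n = of_rat q"
    using quotient_of_div [OF q] by (simp add: of_rat_divide)
  finally show ?thesis
    by (simp add: rat_power_def q)
qed

text \<open>The difference of \<open>f\<close> and \<open>g\<close> is continuous and zero on a
  dense set, hence zero everywhere. This gives the uniqueness that \<open>THE\<close> in
  \<open>real_power\<close> requires.\<close>

lemma continuous_eq_on_rats:
  fixes f g :: "real \<Rightarrow> real"
  assumes "continuous_on UNIV f" and "continuous_on UNIV g"
    and "\<And>q. f (of_rat q) = g (of_rat q)"
  shows "f = g"
proof
  fix x :: real
  have "continuous_on (closure \<rat>) (\<lambda>x. f x - g x)"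
    using assms(1,2) by (auto intro: continuous_on_diff continuous_on_subset)
  moreover have "f y - g y = 0" if "y \<in> \<rat>" for y
    using that assms(3) by (auto elim: Rats_cases)
  moreover have "x \<in> closure \<rat>"
    by (simp add: Rats_closure_real)
  ultimately have "f x - g x = 0"
    by (rule continuous_constant_on_closure)
  then show "f x = g x"
    by simp
qed

lemma real_power_eq_powr:
  assumes "a > 0"
  shows "real_power a = (powr) a"
  unfolding real_power_def
proof (rule the_equality)
  show *: "continuous_on UNIV ((powr) a) \<and> (\<forall>q. a powr of_rat q = rat_power a q)"
    using assms by (auto simp: rat_power_eq_powr intro!: continuous_intros)
  show "f = (powr) a" if "continuous_on UNIV f \<and> (\<forall>q. f (of_rat q) = rat_power a q)" for f
    using that * by (intro continuous_eq_on_rats) auto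
qed

lemma nat_log_eq_ln:
  assumes "a > 0"
  shows "nat_log a = ln a"
proof -
  have "((\<lambda>x. a powr x) has_real_derivative ln a) (at 0)"
    using assms by (auto intro!: derivative_eq_intros)
  then show ?thesis
    unfolding nat_log_def real_power_eq_powr [OF assms] by (rule DERIV_imp_deriv)
qed

lemma euler_e_eq_exp_1: "euler_e = exp 1"
  unfolding euler_e_def
proof (rule the_equality)
  \<comment> \<open>Uniqueness: \<open>e = exp (ln e)\<close>, and
    \<open>ln e = nat_log e = 1\<close>.\<close>
  show "e = exp 1" if "e > 0 \<and> nat_log e = 1" for e
    using that exp_ln [of e] nat_log_eq_ln [of e] by metis
qed (simp add: nat_log_eq_ln)

theorem corollary3p12:
  fixes x :: real
  shows "((\<lambda>t. real_power euler_e t) has_real_derivative real_power euler_e x) (at x)"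
proof -
  \<comment> \<open>Since \<open>exp 1\<close> is nonzero, the special case of \<open>powr\<close>
    for base 0 is excluded, and \<open>exp 1 powr x = exp (x * ln (exp 1)) = exp x\<close>.\<close>
  have "real_power euler_e = exp"
    by (simp add: euler_e_eq_exp_1 real_power_eq_powr powr_def fun_eq_iff)
  then show ?thesis
    by simp
qed

end
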